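(* Let $(\Omega,\mathcal F,\mu)$ be a probability space and let $(\mathcal E,\mathcal D(\mathcal E))$ be a conservative symmetric Dirichlet form on $L^2(\mu)$. Fix $\theta>0$. If, for some $p\in[1,2]$ and some coefficient $A\ge0$, the inequality $$\Psi_p(f)\le A\,r^{-\theta}\,\mathcal E(f,f)+r\,\mathrm{Osc}(f)^2,\qquad r>0,$$ holds for every bounded non-negative $f\in\mathcal D(\mathcal E)$, then for every $1\le q\le p$ the inequality $$\Psi_q(f)\le A\,r^{-\theta}\,\mathcal E(f,f)+r\,\mathrm{Osc}(f)^2,\qquad r>0,$$ holds for every bounded non-negative $f\in\mathcal D(\mathcal E)$, with the same coefficient $A$. Consequently, $$A_{q,\theta}^*\le A_{p,\theta}^*,\qquad C_{q,\theta}^*\le C_{p,\theta}^*,\qquad 1\le q\le p\le 2;$$ equivalently, for each fixed $\theta>0$, both $p\mapsto A_{p,\theta}^*$ and $p\mapsto C_{p,\theta}^*$ are non-decreasing on $[1,2]$.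
   Context: A symmetric Dirichlet form $(\mathcal E,\mathcal D(\mathcal E))$ on $L^2(\mu)$ is called conservative if $1\in\mathcal D(\mathcal E)$ and $\mathcal E(1,1)=0$. For a non-negative $f\in L^2(\mu)$ and $1\le p<2$, with $\mu(g):=\int g\,d\mu$, $$\Psi_p(f):=\frac{\mu(f^2)-\mu(f^p)^{2/p}}{2-p},$$ and $\Psi_2(f):=\tfrac12\mathrm{Ent}_\mu(f^2)$, where $\mathrm{Ent}_\mu(f^2)=\mu(f^2\log f^2)-\mu(f^2)\log\mu(f^2)$ (convention $0\log 0=0$). For bounded $f$, $\mathrm{Osc}(f):=\operatorname{ess\,sup}f-\operatorname{ess\,inf}f$. The optimal constants are defined as follows (with $\inf\emptyset=+\infty$). $A_{p,\theta}^*$ is the infimum of all $A\ge0$ such that $\Psi_p(f)\le A\,r^{-\theta}\mathcal E(f,f)+r\,\mathrm{Osc}(f)^2$ for all $r>0$ and all bounded non-negative $f\in\mathcal D(\mathcal E)$. $C_{p,\theta}^*$ is the infimum of all $C\ge0$ such that $\Psi_p(f)^{1+\theta}\le C\,\mathcal E(f,f)\,\mathrm{Osc}(f)^{2\theta}$ for all bounded non-negative $f\in\mathcal D(\mathcal E)$. *)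

theory Defs
  imports "HOL-Probability.Probability"
begin

text \<open>
  Elements of \<open>L\<^sup>2(\<mu>)\<close> are represented by square-integrable functions. A Dirichlet form is therefore
  given by a set \<open>D\<close> of representatives that is saturated under almost everywhere equality,
  together with a form \<open>E\<close> on \<open>D\<close> that depends only on the almost everywhere classes.
  Values of \<open>E\<close> outside \<open>D\<close> are irrelevant.
\<close>

definition L2 :: "'a measure \<Rightarrow> ('a \<Rightarrow> real) set" where
  "L2 M = {f \<in> borel_measurable M. integrable M (\<lambda>x. (f x)\<^sup>2)}"

text \<open>The squared form norm \<open>\<E>(f,f) + \<mu>(f\<^sup>2)\<close>.\<close>

definition form_norm2 ::
  "'a measure \<Rightarrow> (('a \<Rightarrow> real) \<Rightarrow> ('a \<Rightarrow> real) \<Rightarrow> real) \<Rightarrow> ('a \<Rightarrow> real) \<Rightarrow> real" where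
  "form_norm2 M E f = E f f + (\<integral>x. (f x)\<^sup>2 \<partial>M)"

locale symmetric_dirichlet_form =
  fixes M :: "'a measure"
    and D :: "('a \<Rightarrow> real) set"
    and E :: "('a \<Rightarrow> real) \<Rightarrow> ('a \<Rightarrow> real) \<Rightarrow> real"
  assumes dom_L2: "D \<subseteq> L2 M"
    and dom_AE: "\<lbrakk>f \<in> D; g \<in> borel_measurable M; AE x in M. f x = g x\<rbrakk> \<Longrightarrow> g \<in> D"
    and form_AE: "\<lbrakk>f \<in> D; g \<in> D; h \<in> D; AE x in M. f x = g x\<rbrakk> \<Longrightarrow> E f h = E g h"
    and dom_zero: "(\<lambda>x. 0) \<in> D"
    and dom_add: "\<lbrakk>f \<in> D; g \<in> D\<rbrakk> \<Longrightarrow> (\<lambda>x. f x + g x) \<in> D"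
    and dom_scale: "f \<in> D \<Longrightarrow> (\<lambda>x. c * f x) \<in> D"
    and form_add: "\<lbrakk>f \<in> D; g \<in> D; h \<in> D\<rbrakk> \<Longrightarrow> E (\<lambda>x. f x + g x) h = E f h + E g h"
    and form_scale: "\<lbrakk>f \<in> D; h \<in> D\<rbrakk> \<Longrightarrow> E (\<lambda>x. c * f x) h = c * E f h"
    and form_sym: "\<lbrakk>f \<in> D; g \<in> D\<rbrakk> \<Longrightarrow> E f g = E g f"
    and form_nonneg: "f \<in> D \<Longrightarrow> 0 \<le> E f f"
    and dom_dense: "\<lbrakk>f \<in> L2 M; \<epsilon> > 0\<rbrakk> \<Longrightarrow> \<exists>g\<in>D. (\<integral>x. (f x - g x)\<^sup>2 \<partial>M) < \<epsilon>"
    and form_closed: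
      "\<lbrakk>\<And>n::nat. u n \<in> D;
        \<And>\<epsilon>. \<epsilon> > 0 \<Longrightarrow> \<exists>N. \<forall>m\<ge>N. \<forall>n\<ge>N. form_norm2 M E (\<lambda>x. u m x - u n x) < \<epsilon>\<rbrakk>
       \<Longrightarrow> \<exists>v\<in>D. (\<lambda>n. form_norm2 M E (\<lambda>x. u n x - v x)) \<longlonglongrightarrow> 0"
    and contraction_dom: "f \<in> D \<Longrightarrow> (\<lambda>x. min (max (f x) 0) 1) \<in> D"
    and contraction_form:
      "f \<in> D \<Longrightarrow> E (\<lambda>x. min (max (f x) 0) 1) (\<lambda>x. min (max (f x) 0) 1) \<le> E f f"

locale conservative_symmetric_dirichlet_form = symmetric_dirichlet_form +
  assumes one_dom: "(\<lambda>x. 1) \<in> D"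
    and one_form: "E (\<lambda>x. 1) (\<lambda>x. 1) = 0"

text \<open>
  The convention \<open>0 log 0 = 0\<close> is automatic, since the product vanishes. For bounded \<open>f\<close> on a
  probability space all the integrals below are finite.
\<close>

definition Ent :: "'a measure \<Rightarrow> ('a \<Rightarrow> real) \<Rightarrow> real" where
  "Ent M g = (\<integral>x. g x * ln (g x) \<partial>M) - (\<integral>x. g x \<partial>M) * ln (\<integral>x. g x \<partial>M)"

definition Psi :: "'a measure \<Rightarrow> real \<Rightarrow> ('a \<Rightarrow> real) \<Rightarrow> real" where
  "Psi M p f =
     (if p = 2 then Ent M (\<lambda>x. (f x)\<^sup>2) / 2
      else ((\<integral>x. (f x)\<^sup>2 \<partial>M) - (\<integral>x. f x powr p \<partial>M) powr (2 / p)) / (2 - p))"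

definition essinf :: "'a measure \<Rightarrow> ('a \<Rightarrow> ereal) \<Rightarrow> ereal" where
  "essinf M f = - esssup M (\<lambda>x. - f x)"

text \<open>Only meaningful for essentially bounded \<open>f\<close>.\<close>

definition Osc :: "'a measure \<Rightarrow> ('a \<Rightarrow> real) \<Rightarrow> real" where
  "Osc M f = real_of_ereal (esssup M (\<lambda>x. ereal (f x)) - essinf M (\<lambda>x. ereal (f x)))"

definition bounded_nonneg :: "'a measure \<Rightarrow> ('a \<Rightarrow> real) set \<Rightarrow> ('a \<Rightarrow> real) set" where
  "bounded_nonneg M D = {f \<in> D. (AE x in M. 0 \<le> f x) \<and> (\<exists>c. AE x in M. \<bar>f x\<bar> \<le> c)}"

definition weak_ineq ::
  "'a measure \<Rightarrow> ('a \<Rightarrow> real) set \<Rightarrow> (('a \<Rightarrow> real) \<Rightarrow> ('a \<Rightarrow> real) \<Rightarrow> real)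
    \<Rightarrow> real \<Rightarrow> real \<Rightarrow> real \<Rightarrow> bool" where
  "weak_ineq M D E p \<theta> A \<longleftrightarrow>
     (\<forall>f\<in>bounded_nonneg M D. \<forall>r>0.
        Psi M p f \<le> A * r powr (-\<theta>) * E f f + r * (Osc M f)\<^sup>2)"

definition nash_ineq ::
  "'a measure \<Rightarrow> ('a \<Rightarrow> real) set \<Rightarrow> (('a \<Rightarrow> real) \<Rightarrow> ('a \<Rightarrow> real) \<Rightarrow> real)
    \<Rightarrow> real \<Rightarrow> real \<Rightarrow> real \<Rightarrow> bool" where
  "nash_ineq M D E p \<theta> C \<longleftrightarrow>
     (\<forall>f\<in>bounded_nonneg M D.
        Psi M p f powr (1 + \<theta>) \<le> C * E f f * Osc M f powr (2 * \<theta>))"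

text \<open>In \<^typ>\<open>ereal\<close> the infimum of the empty set is \<open>\<infinity>\<close>.\<close>

definition A_opt ::
  "'a measure \<Rightarrow> ('a \<Rightarrow> real) set \<Rightarrow> (('a \<Rightarrow> real) \<Rightarrow> ('a \<Rightarrow> real) \<Rightarrow> real)
    \<Rightarrow> real \<Rightarrow> real \<Rightarrow> ereal" where
  "A_opt M D E p \<theta> = Inf {ereal A | A. 0 \<le> A \<and> weak_ineq M D E p \<theta> A}"

definition C_opt ::
  "'a measure \<Rightarrow> ('a \<Rightarrow> real) set \<Rightarrow> (('a \<Rightarrow> real) \<Rightarrow> ('a \<Rightarrow> real) \<Rightarrow> real)
    \<Rightarrow> real \<Rightarrow> real \<Rightarrow> ereal" where
  "C_opt M D E p \<theta> = Inf {ereal C | C. 0 \<le> C \<and> nash_ineq M D E p \<theta> C}"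

end

theory Submission
  imports Defs
begin

text \<open>
  The functionals \<open>\<Psi>\<^sub>p(f)\<close> are not monotone in \<open>p\<close> for a fixed \<open>f\<close>: for the indicator of a set of
  measure \<open>1 - \<delta>\<close> with small \<open>\<delta>\<close>, \<open>\<Psi>\<^sub>1\<close> is about \<open>\<delta>\<close> while \<open>\<Psi>\<^sub>2\<close> is about \<open>\<delta> / 2\<close>. The right-hand
  sides of the inequalities, however, contain only \<open>\<E>(f,f)\<close> and \<open>Osc(f)\<close>, and both are
  invariant under \<open>f \<mapsto> f + c\<close>: the oscillation trivially, the energy because the form is
  conservative (\<open>form_shift\<close>). It is therefore enough that \<open>\<Psi>\<^sub>q(f)\<close> does not exceed the supremum of
  \<open>\<Psi>\<^sub>p(f + c)\<close> over \<open>c \<ge> 0\<close> (\<open>Psi_le_Psi_shift\<close>).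

  This supremum is controlled by letting \<open>c\<close> grow together with the exponent. Along the flow
  \<open>c'(s) = \<parallel>f + c\<parallel>\<^sub>s / (s - 1)\<close> the function \<open>s \<mapsto> \<Psi>\<^sub>s(f + c(s))\<close> is nondecreasing for \<open>1 < s < 2\<close>
  (\<open>Psi_deriv_along_flow\<close>): after normalising \<open>\<parallel>f + c\<parallel>\<^sub>s = 1\<close>, its derivative is the integral of an
  explicit function of one real variable, evaluated at \<open>f + c\<close>, which is nonnegative by
  \<open>pointwise_key_inequality\<close>. The flow is not solved; a maximum argument on a compact set of pairs
  \<open>(s, c)\<close> extracts the comparison from the infinitesimal statement, for \<open>1 < q < p < 2\<close> and \<open>f\<close>
  bounded away from \<open>0\<close> (\<open>Psi_le_Psi_shift_bounded_below\<close>).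

  Vanishing \<open>f\<close> and \<open>q = 1\<close> follow by continuity of \<open>\<Psi>\<close> in \<open>(s, c)\<close>. For \<open>p = 2\<close>, where \<open>\<Psi>\<close> is an
  entropy, the bound \<open>(s / 2) \<Psi>\<^sub>s \<le> \<Psi>\<^sub>2\<close> is used as \<open>s\<close> tends to \<open>2\<close> (\<open>Psi_le_Psi_2\<close>). Both
  functional inequalities then pass from \<open>p\<close> to \<open>q\<close> with the same constant, and the infima inherit
  the order.
\<close>

section \<open>A pointwise inequality with a fourth-order zero\<close>

lemma nonneg_if_deriv_sign_at_1:
  fixes h h' :: "real \<Rightarrow> real"
  assumes der: "\<And>x. x > 0 \<Longrightarrow> (h has_real_derivative h' x) (at x)"
    and right: "\<And>x. x \<ge> 1 \<Longrightarrow> h' x \<ge> 0"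
    and left: "\<And>x. 0 < x \<Longrightarrow> x \<le> 1 \<Longrightarrow> h' x \<le> 0"
    and zero: "h 1 = 0" and "x > 0"
  shows "h x \<ge> 0"
proof (cases "x \<ge> 1")
  case True
  have "h 1 \<le> h x"
    by (rule DERIV_nonneg_imp_nondecreasing[OF True])
       (use der right in \<open>metis less_le_trans zero_less_one\<close>)
  then show ?thesis using zero by simp
next
  case False
  have "h 1 \<le> h x"
    by (rule DERIV_nonpos_imp_nonincreasing[of x 1])
       (use der left False \<open>x > 0\<close> in \<open>auto, meson less_le_trans\<close>)
  then show ?thesis using zero by simp
qed

text \<open>
  Up to the positive factor \<open>2 x powr (- r)\<close> with \<open>r = 2 - s\<close>, this expression is the second derivative of
  the function in \<open>pointwise_key_inequality\<close>. It vanishes at \<open>1\<close>, and its derivative is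
  \<open>r / x\<^sup>2\<close> times \<open>x powr (r + 1) - (1 - r) x - r\<close>, which has the sign of \<open>x - 1\<close> because
  \<open>x powr (r + 1)\<close> lies above \<open>x\<close> for \<open>x \<ge> 1\<close> and below it for \<open>x \<le> 1\<close>.
\<close>

lemma powr_log_defect_nonneg:
  fixes r x :: real
  assumes r: "0 \<le> r" "r \<le> 1" and "x > 0"
  shows "0 \<le> x powr r - r * (1 - r) * ln x - (1 + r\<^sup>2) + r\<^sup>2 / x"
proof (rule nonneg_if_deriv_sign_at_1[where x = x
    and h' = "\<lambda>x. r * (x powr (r + 1) - (1 - r) * x - r) / x\<^sup>2"])
  fix x :: real assume x: "x > 0"
  have e: "r * x powr (r - 1) - r * (1 - r) / x - r\<^sup>2 / x\<^sup>2
     = r * (x powr (r + 1) - (1 - r) * x - r) / x\<^sup>2"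
    using x by (simp add: powr_add powr_diff field_simps power2_eq_square)
  show "((\<lambda>x. x powr r - r * (1 - r) * ln x - (1 + r\<^sup>2) + r\<^sup>2 / x)
      has_real_derivative r * (x powr (r + 1) - (1 - r) * x - r) / x\<^sup>2) (at x)"
    unfolding e[symmetric] using x
    by (auto intro!: derivative_eq_intros simp: field_simps power2_eq_square)
next
  fix x :: real assume x: "x \<ge> 1"
  have "x powr 1 \<le> x powr (r + 1)" using x r by (intro powr_mono) auto
  moreover have "0 \<le> r * (x - 1)" using x r by simp
  ultimately have "0 \<le> x powr (r + 1) - (1 - r) * x - r" using x by (simp add: algebra_simps)
  then show "0 \<le> r * (x powr (r + 1) - (1 - r) * x - r) / x\<^sup>2" using r by simp
next
  fix x :: real assume x: "0 < x" "x \<le> 1"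
  have "x powr (r + 1) \<le> x powr 1" using x r by (intro powr_mono') auto
  moreover have "0 \<le> r * (1 - x)" using x r by simp
  ultimately have "x powr (r + 1) - (1 - r) * x - r \<le> 0" using x by (simp add: algebra_simps)
  then show "r * (x powr (r + 1) - (1 - r) * x - r) / x\<^sup>2 \<le> 0"
    using r by (simp add: divide_nonpos_nonneg mult_nonneg_nonpos)
qed (use \<open>x > 0\<close> in auto)

lemma has_real_derivative_powr_times_ln:
  fixes a x :: real
  assumes "x > 0"
  shows "((\<lambda>x. x powr a * ln x) has_real_derivative a * x powr (a - 1) * ln x + x powr (a - 1)) (at x)"
proof -
  have "((\<lambda>x. x powr a * ln x) has_real_derivative
      a * x powr (a - 1) * ln x + inverse x * x powr a) (at x)"
    using assms by (intro DERIV_mult has_real_derivative_powr DERIV_ln)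
  moreover have "inverse x * x powr a = x powr (a - 1)"
    using assms by (simp add: powr_diff field_simps)
  ultimately show ?thesis by simp
qed

text \<open>
  Evaluated at \<open>f\<close> with \<open>\<mu>(f powr s) = 1\<close> and integrated, the terms without \<open>\<alpha>\<close> and \<open>\<beta>\<close> give the
  derivative of \<open>\<Psi>\<^sub>s(f)\<close> in \<open>s\<close>, up to the factor \<open>(2 - s)\<^sup>2\<close>; the term with \<open>\<beta>\<close> gives a multiple
  of its derivative under translations of \<open>f\<close>, and the term with \<open>\<alpha>\<close> integrates to \<open>0\<close>. For
  \<open>s < 2\<close> the multipliers are forced: near constant functions \<open>\<Psi>\<^sub>s\<close> is the variance to leading order for every \<open>s\<close>, so the function has to vanish
  to fourth order at \<open>x = 1\<close>. Vanishing of the first and third derivatives determines \<open>\<alpha>\<close> and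
  \<open>\<beta>\<close>, and the second derivative is then automatically \<open>0\<close> at \<open>1\<close>. With this choice the
  function is convex, by \<open>powr_log_defect_nonneg\<close>, with minimum \<open>0\<close> at \<open>1\<close>.
\<close>

lemma pointwise_key_inequality:
  fixes s x :: real
  defines "\<beta> \<equiv> 2 * (2 - s) / (s - 1)"
  defines "\<alpha> \<equiv> (4 * (s - 1) / s + (2 - s) * \<beta>) / s"
  assumes s: "1 < s" "s \<le> 2" and "x > 0"
  shows "0 \<le> x\<^sup>2 - 1 - 2 * (2 - s) / s * (x powr s * ln x)
            - \<alpha> * (x powr s - 1) - \<beta> * (x powr (s - 1) - x)"
proof -
  define \<kappa> where "\<kappa> = 2 * (2 - s) / s"
  define \<gamma> where "\<gamma> = 2 + \<beta> * (2 - s)"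
  have ks: "\<kappa> * s = 2 * (2 - s)" and bs: "\<beta> * (s - 1) = 2 * (2 - s)"
    and as: "\<alpha> * s = \<gamma> - \<kappa>"
    using s by (auto simp: \<kappa>_def \<beta>_def \<alpha>_def \<gamma>_def field_simps)
  define d where "d = (\<lambda>x. 2 * x - 2 * (2 - s) * (x powr (s - 1) * ln x) - \<gamma> * x powr (s - 1)
      - 2 * (2 - s) * x powr (s - 2) + \<beta>)"
  define dd where "dd = (\<lambda>x. 2 - 2 * (2 - s) * ((s - 1) * x powr (s - 2) * ln x + x powr (s - 2))
      - \<gamma> * (s - 1) * x powr (s - 2) - 2 * (2 - s) * (s - 2) * x powr (s - 3))"
  have D2: "(d has_real_derivative dd x) (at x)" if x: "x > 0" for x
  proof -
    have "(d has_real_derivative 2 * 1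
      - 2 * (2 - s) * ((s - 1) * x powr (s - 1 - 1) * ln x + x powr (s - 1 - 1))
      - \<gamma> * ((s - 1) * x powr (s - 1 - 1)) - 2 * (2 - s) * ((s - 2) * x powr (s - 2 - 1)) + 0) (at x)"
      unfolding d_def using x
      by (intro DERIV_add DERIV_diff DERIV_cmult DERIV_ident DERIV_const
          has_real_derivative_powr has_real_derivative_powr_times_ln)
    then show ?thesis unfolding dd_def by (simp add: algebra_simps)
  qed
  have dd: "dd x \<ge> 0" if x: "x > 0" for x
  proof -
    have g: "\<gamma> * (s - 1) = 2 * (s - 1) + 2 * (2 - s)\<^sup>2"
    proof -
      have "\<gamma> * (s - 1) = 2 * (s - 1) + (\<beta> * (s - 1)) * (2 - s)"
        by (simp add: \<gamma>_def algebra_simps)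
      then show ?thesis unfolding bs by (simp add: power2_eq_square)
    qed
    have e: "x powr (s - 3) = x powr (s - 2) / x" "x powr (2 - s) = 1 / x powr (s - 2)"
      using x by (auto simp: powr_diff power2_eq_square power3_eq_cube field_simps powr_numeral)
    have "dd x = 2 * x powr (s - 2) * (x powr (2 - s) - (2 - s) * (1 - (2 - s)) * ln x
        - (1 + (2 - s)\<^sup>2) + (2 - s)\<^sup>2 / x)"
      unfolding dd_def g e using x by (simp add: field_simps power2_eq_square)
    with powr_log_defect_nonneg[of "2 - s" x] s x show ?thesis by simp
  qed
  have d1: "d 1 = 0" unfolding d_def \<gamma>_def using bs by (simp add: algebra_simps)
  have mono: "d a \<le> d b" if "0 < a" "a \<le> b" for a b
    by (rule DERIV_nonneg_imp_nondecreasing[OF that(2)])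
       (use D2 dd that(1) in \<open>meson less_le_trans\<close>)
  show ?thesis unfolding \<kappa>_def[symmetric]
  proof (rule nonneg_if_deriv_sign_at_1[where x = x and h' = d])
    fix x :: real assume x: "x > 0"
    have e: "d x = 2 * x - \<kappa> * (s * x powr (s - 1) * ln x + x powr (s - 1))
        - \<alpha> * (s * x powr (s - 1)) - \<beta> * ((s - 1) * x powr (s - 2) - 1)"
    proof -
      have "\<kappa> * (s * x powr (s - 1) * ln x + x powr (s - 1)) + \<alpha> * (s * x powr (s - 1))
          + \<beta> * ((s - 1) * x powr (s - 2) - 1)
         = (\<kappa> * s) * (x powr (s - 1) * ln x) + (\<kappa> + \<alpha> * s) * x powr (s - 1)
          + (\<beta> * (s - 1)) * x powr (s - 2) - \<beta>" by (simp add: algebra_simps)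
      also have "\<dots> = 2 * x - d x" unfolding ks bs as d_def by simp
      finally show ?thesis by simp
    qed
    show "((\<lambda>x. x\<^sup>2 - 1 - \<kappa> * (x powr s * ln x) - \<alpha> * (x powr s - 1)
        - \<beta> * (x powr (s - 1) - x)) has_real_derivative d x) (at x)"
    proof -
      have "((\<lambda>x. x\<^sup>2 - 1 - \<kappa> * (x powr s * ln x) - \<alpha> * (x powr s - 1)
        - \<beta> * (x powr (s - 1) - x)) has_real_derivative
          2 * x - 0 - \<kappa> * (s * x powr (s - 1) * ln x + x powr (s - 1))
          - \<alpha> * (s * x powr (s - 1) - 0) - \<beta> * ((s - 1) * x powr (s - 1 - 1) - 1)) (at x)"
        using x
        by (intro DERIV_diff DERIV_cmult DERIV_ident DERIV_const
            has_real_derivative_powr has_real_derivative_powr_times_ln)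
          (auto intro!: derivative_eq_intros)
      then show ?thesis unfolding e by simp
    qed
  qed (use \<open>x > 0\<close> mono[of 1] mono[of _ 1] d1 in auto)
qed

section \<open>Monotonicity along a flow of translations\<close>

text \<open>
  For a bounded function, compactness of \<open>[-d, d] \<times> [a, b]\<close> bounds the difference quotients
  uniformly, so dominated convergence applies.
\<close>

lemma has_real_derivative_integral_at_0:
  fixes h h' :: "real \<Rightarrow> real \<Rightarrow> real"
  assumes "prob_space M" and f [measurable]: "f \<in> borel_measurable M"
    and range: "\<And>x. x \<in> space M \<Longrightarrow> f x \<in> {a..b}"
    and d: "d > 0"
    and meas [measurable]: "\<And>t. h t \<in> borel_measurable borel"
    and cont_h: "continuous_on ({-d..d} \<times> {a..b}) (\<lambda>z. h (fst z) (snd z))"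
    and der: "\<And>y t. y \<in> {a..b} \<Longrightarrow> \<bar>t\<bar> \<le> d \<Longrightarrow> ((\<lambda>t. h t y) has_real_derivative h' t y) (at t)"
    and cont: "continuous_on ({-d..d} \<times> {a..b}) (\<lambda>z. h' (fst z) (snd z))"
    and meas' [measurable]: "h' 0 \<in> borel_measurable borel"
  shows "((\<lambda>t. \<integral>x. h t (f x) \<partial>M) has_real_derivative (\<integral>x. h' 0 (f x) \<partial>M)) (at 0)"
proof -
  interpret prob_space M by fact
  have bound: "\<exists>K. \<forall>t y. \<bar>t\<bar> \<le> d \<longrightarrow> y \<in> {a..b} \<longrightarrow> \<bar>g t y\<bar> \<le> K"
    if "continuous_on ({-d..d} \<times> {a..b}) (\<lambda>z. g (fst z) (snd z))" for g :: "real \<Rightarrow> real \<Rightarrow> real"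
  proof -
    have "compact ((\<lambda>z. g (fst z) (snd z)) ` ({-d..d} \<times> {a..b}))"
      by (intro compact_continuous_image that compact_Times) auto
    then obtain K where "\<forall>y\<in>(\<lambda>z. g (fst z) (snd z)) ` ({-d..d} \<times> {a..b}). norm y \<le> K"
      using compact_imp_bounded bounded_iff by metis
    then show ?thesis by (intro exI[of _ K]) force
  qed
  obtain C where bdd: "\<And>t y. \<bar>t\<bar> \<le> d \<Longrightarrow> y \<in> {a..b} \<Longrightarrow> \<bar>h t y\<bar> \<le> C"
    using bound[OF cont_h] by blast
  obtain K where K: "\<And>t y. \<bar>t\<bar> \<le> d \<Longrightarrow> y \<in> {a..b} \<Longrightarrow> \<bar>h' t y\<bar> \<le> K"
    using bound[OF cont] by blast
  have int: "integrable M (\<lambda>x. h t (f x))" if "\<bar>t\<bar> \<le> d" for t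
    by (rule integrable_const_bound[of _ C]) (use bdd range that in auto)
  show ?thesis
    unfolding has_field_derivative_iff tendsto_at_iff_sequentially
  proof (intro allI impI)
    fix X :: "nat \<Rightarrow> real" assume X: "\<forall>i. X i \<in> UNIV - {0}" and lim: "X \<longlonglongrightarrow> 0"
    then obtain N where N: "\<And>n. n \<ge> N \<Longrightarrow> \<bar>X n\<bar> < d"
      using d LIMSEQ_iff by (metis diff_zero real_norm_def)
    define Y where "Y n = X (n + N)" for n
    have Y: "Y n \<noteq> 0" "\<bar>Y n\<bar> \<le> d" for n using X N[of "n + N"] by (auto simp: Y_def)
    have Ylim: "Y \<longlonglongrightarrow> 0" unfolding Y_def using lim by (rule LIMSEQ_ignore_initial_segment)
    have quot: "(\<integral>x. h (Y n) (f x) \<partial>M) - (\<integral>x. h 0 (f x) \<partial>M)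
        = (\<integral>x. h (Y n) (f x) - h 0 (f x) \<partial>M)" for n
      using int[of 0] int[OF Y(2)] d by simp
    have "(\<lambda>n. \<integral>x. (h (Y n) (f x) - h 0 (f x)) / Y n \<partial>M) \<longlonglongrightarrow> (\<integral>x. h' 0 (f x) \<partial>M)"
    proof (rule integral_dominated_convergence[where w = "\<lambda>_. K"])
      show "AE x in M. (\<lambda>n. (h (Y n) (f x) - h 0 (f x)) / Y n) \<longlonglongrightarrow> h' 0 (f x)"
      proof (rule AE_I2)
        fix x assume x: "x \<in> space M"
        have "((\<lambda>t. (h t (f x) - h 0 (f x)) / (t - 0)) \<longlongrightarrow> h' 0 (f x)) (at 0)"
          using der[OF range[OF x], of 0] d unfolding has_field_derivative_iff by simp
        then show "(\<lambda>n. (h (Y n) (f x) - h 0 (f x)) / Y n) \<longlonglongrightarrow> h' 0 (f x)"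
          unfolding tendsto_at_iff_sequentially using Y Ylim by (auto simp: o_def)
      qed
      show "AE x in M. norm ((h (Y n) (f x) - h 0 (f x)) / Y n) \<le> K" for n
      proof (rule AE_I2)
        fix x assume x: "x \<in> space M"
        have "norm (h (Y n) (f x) - h 0 (f x)) \<le> K * norm (Y n - 0)"
        proof (rule field_differentiable_bound[of "{-d..d}"])
          show "((\<lambda>t. h t (f x)) has_field_derivative h' t (f x)) (at t within {-d..d})"
            if "t \<in> {-d..d}" for t
            by (rule has_field_derivative_at_within) (use der[OF range[OF x]] that in auto)
          show "norm (h' t (f x)) \<le> K" if "t \<in> {-d..d}" for t
            using K[of t] range[OF x] that by auto
        qed (use Y(2)[of n] d in auto)
        then show "norm ((h (Y n) (f x) - h 0 (f x)) / Y n) \<le> K"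
          using Y(1)[of n] by (simp add: field_simps)
      qed
    qed auto
    then have "(\<lambda>n. ((\<integral>x. h (Y n) (f x) \<partial>M) - (\<integral>x. h 0 (f x) \<partial>M)) / (Y n - 0))
        \<longlonglongrightarrow> (\<integral>x. h' 0 (f x) \<partial>M)" unfolding quot by simp
    then show "((\<lambda>y. ((\<integral>x. h y (f x) \<partial>M) - (\<integral>x. h 0 (f x) \<partial>M)) / (y - 0)) \<circ> X)
        \<longlonglongrightarrow> (\<integral>x. h' 0 (f x) \<partial>M)"
      unfolding Y_def o_def by (rule LIMSEQ_offset)
  qed
qed

lemma (in prob_space) integrable_continuous_compose:
  fixes f :: "'a \<Rightarrow> real" and g :: "real \<Rightarrow> real"
  assumes [measurable]: "f \<in> borel_measurable M" "g \<in> borel_measurable borel"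
    and range: "\<And>x. x \<in> space M \<Longrightarrow> f x \<in> {a..b}" and cont: "continuous_on {a..b} g"
  shows "integrable M (\<lambda>x. g (f x))"
proof -
  obtain K where "\<forall>y\<in>g ` {a..b}. norm y \<le> K"
    using compact_continuous_image[OF cont] compact_imp_bounded bounded_iff
    by (metis compact_Icc)
  then show ?thesis
    by (intro integrable_const_bound[of _ K]) (use range in auto)
qed

text \<open>
  If \<open>f\<close> has unit \<open>L\<^sup>s\<close> norm, the derivative at \<open>t = 0\<close> is the integral of the function in
  \<open>pointwise_key_inequality\<close>, evaluated at \<open>f\<close>, divided by \<open>(2 - s)\<^sup>2\<close>. The speed
  \<open>1 / (s - 1)\<close> of the translation is what produces the multiplier \<open>\<beta>\<close>.
\<close>

lemma Psi_deriv_along_flow_normalized: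
  assumes "prob_space M" and f [measurable]: "f \<in> borel_measurable M"
    and "0 < a" and range: "\<And>x. x \<in> space M \<Longrightarrow> f x \<in> {a..b}"
    and s: "1 < s" "s < 2" and norm1: "(\<integral>x. f x powr s \<partial>M) = 1"
  shows "\<exists>l\<ge>0. ((\<lambda>t. Psi M (s + t) (\<lambda>x. f x + t / (s - 1))) has_real_derivative l) (at 0)"
proof -
  interpret prob_space M by fact
  define v where "v = 1 / (s - 1)"
  define d where "d = min (a * (s - 1) / 2) (s - 1)"
  have d: "d > 0" using \<open>0 < a\<close> s by (simp add: d_def)
  have pos: "y + t * v > 0" if "y \<in> {a..b}" "\<bar>t\<bar> \<le> d" for y t
  proof -
    have "\<bar>t\<bar> * v \<le> a * (s - 1) / 2 * v"
      using that s by (intro mult_right_mono) (auto simp: v_def d_def)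
    also have "\<dots> = a / 2" using s by (simp add: v_def divide_simps)
    finally have "\<bar>t * v\<bar> \<le> a / 2" using s by (simp add: abs_mult v_def)
    then show ?thesis using that \<open>0 < a\<close> by auto
  qed
  have ne: "y + t * v \<noteq> 0" if "y \<in> {a..b}" "\<bar>t\<bar> \<le> d" for y t using pos[OF that] by simp
  have fpos: "f x > 0" if "x \<in> space M" for x using range[OF that] \<open>0 < a\<close> by auto
  note int = integrable_continuous_compose[OF f _ range]
  define X1 where "X1 = (\<integral>x. f x \<partial>M)"
  define X2 where "X2 = (\<integral>x. (f x)\<^sup>2 \<partial>M)"
  define Xl where "Xl = (\<integral>x. f x powr s * ln (f x) \<partial>M)"
  define Xs where "Xs = (\<integral>x. f x powr (s - 1) \<partial>M)"
  have i1: "integrable M f" by (rule int) (auto intro!: continuous_intros)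
  have i2: "integrable M (\<lambda>x. (f x)\<^sup>2)" by (rule int) (auto intro!: continuous_intros)
  have il: "integrable M (\<lambda>x. f x powr s * ln (f x))"
    by (rule int) (use \<open>0 < a\<close> in \<open>auto intro!: continuous_intros\<close>)
  have ipow': "integrable M (\<lambda>x. f x powr (s - 1))"
    by (rule int) (use \<open>0 < a\<close> in \<open>auto intro!: continuous_intros\<close>)
  have ipow: "integrable M (\<lambda>x. f x powr s)"
    by (rule int) (use \<open>0 < a\<close> in \<open>auto intro!: continuous_intros\<close>)
  have DP: "((\<lambda>t. \<integral>x. (f x + t * v)\<^sup>2 \<partial>M) has_real_derivative 2 * v * X1) (at 0)"
  proof -
    have "((\<lambda>t. \<integral>x. (f x + t * v)\<^sup>2 \<partial>M) has_real_derivative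
        (\<integral>x. 2 * v * (f x + 0 * v) \<partial>M)) (at 0)"
      by (rule has_real_derivative_integral_at_0[where a = a and b = b and d = d
            and h = "\<lambda>t y. (y + t * v)\<^sup>2" and h' = "\<lambda>t y. 2 * v * (y + t * v)"])
         (use assms d in \<open>auto intro!: continuous_intros derivative_eq_intros\<close>)
    then show ?thesis unfolding X1_def by simp
  qed
  have DQ: "((\<lambda>t. \<integral>x. (f x + t * v) powr (s + t) \<partial>M) has_real_derivative Xl + v * s * Xs) (at 0)"
  proof -
    have "((\<lambda>t. \<integral>x. (f x + t * v) powr (s + t) \<partial>M) has_real_derivative
        (\<integral>x. (f x + 0 * v) powr (s + 0) * (1 * ln (f x + 0 * v) + v * (s + 0) / (f x + 0 * v)) \<partial>M)) (at 0)"
    proof (rule has_real_derivative_integral_at_0[where a = a and b = b and d = d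
            and h = "\<lambda>t y. (y + t * v) powr (s + t)"
            and h' = "\<lambda>t y. (y + t * v) powr (s + t) * (1 * ln (y + t * v) + v * (s + t) / (y + t * v))"])
      show "((\<lambda>t. (y + t * v) powr (s + t)) has_real_derivative
          (y + t * v) powr (s + t) * (1 * ln (y + t * v) + v * (s + t) / (y + t * v))) (at t)"
        if "y \<in> {a..b}" "\<bar>t\<bar> \<le> d" for y t
        by (rule DERIV_powr) (use pos[OF that] in \<open>auto intro!: derivative_eq_intros\<close>)
      show "continuous_on ({- d..d} \<times> {a..b}) (\<lambda>z. (snd z + fst z * v) powr (s + fst z))"
        by (intro continuous_intros) (use ne in force)
      show "continuous_on ({- d..d} \<times> {a..b}) (\<lambda>z. (snd z + fst z * v) powr (s + fst z)
          * (1 * ln (snd z + fst z * v) + v * (s + fst z) / (snd z + fst z * v)))"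
        by (intro continuous_intros) (use ne in force)+
    qed (use assms d in auto)
    also have "(\<integral>x. (f x + 0 * v) powr (s + 0) * (1 * ln (f x + 0 * v) + v * (s + 0) / (f x + 0 * v)) \<partial>M)
        = (\<integral>x. f x powr s * ln (f x) + v * s * f x powr (s - 1) \<partial>M)"
    proof (intro Bochner_Integration.integral_cong refl)
      fix x assume "x \<in> space M"
      from fpos[OF this] show "(f x + 0 * v) powr (s + 0) * (1 * ln (f x + 0 * v) + v * (s + 0) / (f x + 0 * v))
          = f x powr s * ln (f x) + v * s * f x powr (s - 1)"
        by (simp add: powr_diff algebra_simps)
    qed
    also have "\<dots> = Xl + v * s * Xs"
      unfolding Xl_def Xs_def using il ipow' by simp
    finally show ?thesis .
  qed
  let ?P = "\<lambda>t. \<integral>x. (f x + t * v)\<^sup>2 \<partial>M" and ?Q = "\<lambda>t. \<integral>x. (f x + t * v) powr (s + t) \<partial>M"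
  have Q0: "?Q 0 = 1" using norm1 by simp
  have P0: "?P 0 = X2" by (simp add: X2_def)
  have e2: "((\<lambda>t. 2 / (s + t)) has_real_derivative - 2 / s\<^sup>2) (at 0)"
    using s by (auto intro!: derivative_eq_intros simp: power2_eq_square)
  have DR: "((\<lambda>t. ?Q t powr (2 / (s + t))) has_real_derivative 2 / s * (Xl + v * s * Xs)) (at 0)"
    using DERIV_powr[OF DQ _ e2] Q0 norm1 by (simp add: mult.commute)
  define Y where "Y = ((2 * v * X1 - 2 / s * (Xl + v * s * Xs)) * (2 - s) + (X2 - 1)) / (2 - s)\<^sup>2"
  have D: "((\<lambda>t. (?P t - ?Q t powr (2 / (s + t))) / (2 - (s + t))) has_real_derivative Y) (at 0)"
    unfolding Y_def
    by (rule derivative_eq_intros DP DR | use s Q0 P0 norm1 in \<open>simp add: power2_eq_square X2_def\<close>)+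
  have "((\<lambda>t. Psi M (s + t) (\<lambda>x. f x + t / (s - 1))) has_real_derivative Y) (at 0)"
  proof (rule DERIV_cong_ev[THEN iffD2, OF refl _ refl D])
    have "\<forall>\<^sub>F t in nhds (0::real). t < 2 - s"
      by (rule order_tendstoD[OF filterlim_ident]) (use s in auto)
    then show "\<forall>\<^sub>F t in nhds 0. Psi M (s + t) (\<lambda>x. f x + t / (s - 1))
        = (?P t - ?Q t powr (2 / (s + t))) / (2 - (s + t))"
      by eventually_elim (simp add: Psi_def v_def)
  qed
  moreover have "Y \<ge> 0"
  proof -
    define \<beta> where "\<beta> = 2 * (2 - s) / (s - 1)"
    define \<alpha> where "\<alpha> = (4 * (s - 1) / s + (2 - s) * \<beta>) / s"
    (* The term with the factor \<alpha> integrates to 0 because of the normalisation. *)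
    have "0 \<le> (\<integral>x. (f x)\<^sup>2 - 1 - 2 * (2 - s) / s * (f x powr s * ln (f x))
            - \<alpha> * (f x powr s - 1) - \<beta> * (f x powr (s - 1) - f x) \<partial>M)"
      unfolding \<alpha>_def \<beta>_def using pointwise_key_inequality[of s] s fpos
      by (intro Bochner_Integration.integral_nonneg_AE AE_I2) auto
    also have "\<dots> = X2 - 1 - 2 * (2 - s) / s * Xl - \<alpha> * (1 - 1) - \<beta> * (Xs - X1)"
      using i1 i2 il ipow ipow' norm1 by (simp add: X1_def X2_def Xs_def Xl_def prob_space)
    also have "\<dots> = (2 * v * X1 - 2 / s * (Xl + v * s * Xs)) * (2 - s) + (X2 - 1)"
    proof -
      have "2 / s * (Xl + v * s * Xs) = 2 / s * Xl + 2 * v * Xs" using s by (simp add: distrib_left)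
      moreover have "\<beta> = 2 * v * (2 - s)" by (simp add: \<beta>_def v_def)
      moreover have "2 * (2 - s) / s * Xl = 2 / s * Xl * (2 - s)" by simp
      ultimately show ?thesis by (simp only: ring_distribs) simp
    qed
    finally show ?thesis unfolding Y_def by simp
  qed
  ultimately show ?thesis by blast
qed

lemma Psi_scale:
  assumes "k > 0" "0 < s" "s < 2" and nonneg: "\<And>x. x \<in> space M \<Longrightarrow> 0 \<le> f x"
  shows "Psi M s (\<lambda>x. k * f x) = k\<^sup>2 * Psi M s f"
proof -
  have "(\<integral>x. (k * f x) powr s \<partial>M) = k powr s * (\<integral>x. f x powr s \<partial>M)"
    unfolding integral_mult_right_zero[symmetric]
    by (intro Bochner_Integration.integral_cong refl powr_mult)
  moreover have "(k powr s * (\<integral>x. f x powr s \<partial>M)) powr (2 / s) = k\<^sup>2 * (\<integral>x. f x powr s \<partial>M) powr (2 / s)"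
    using assms by (subst powr_mult) (auto intro!: Bochner_Integration.integral_nonneg simp: powr_powr)
  ultimately show ?thesis
    using assms by (simp add: Psi_def power_mult_distrib field_simps)
qed

text \<open>
  By homogeneity the normalised case gives, for general \<open>f\<close>, the speed \<open>n / (s - 1)\<close> with \<open>n\<close> the
  \<open>L\<^sup>s\<close> norm of \<open>f\<close>. The bound \<open>n \<le> b\<close> confines the flow to a compact region in
  \<open>Psi_le_Psi_shift_bounded_below\<close>.
\<close>

lemma Psi_deriv_along_flow:
  assumes "prob_space M" and f [measurable]: "f \<in> borel_measurable M"
    and "0 < a" and range: "\<And>x. x \<in> space M \<Longrightarrow> f x \<in> {a..b}"
    and s: "1 < s" "s < 2"
  shows "\<exists>n l. 0 < n \<and> n \<le> b \<and> 0 \<le> l \<and>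
    ((\<lambda>t. Psi M (s + t) (\<lambda>x. f x + t * (n / (s - 1)))) has_real_derivative l) (at 0)"
proof -
  interpret prob_space M by fact
  have fpos: "f x > 0" if "x \<in> space M" for x using range[OF that] \<open>0 < a\<close> by auto
  obtain x0 where "x0 \<in> space M" using not_empty by blast
  with range[of x0] \<open>0 < a\<close> have b: "b > 0" by auto
  define N where "N = (\<integral>x. f x powr s \<partial>M)"
  define n where "n = N powr (1 / s)"
  have le: "a powr s \<le> f x powr s" "f x powr s \<le> b powr s" if "x \<in> space M" for x
    using range[OF that] \<open>0 < a\<close> s by (auto intro!: powr_mono2)
  have int: "integrable M (\<lambda>x. f x powr s)"
    by (rule integrable_const_bound[of _ "b powr s"]) (use le in auto)
  have "a powr s \<le> N" unfolding N_def
    by (rule integral_ge_const[OF int]) (use le in auto)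
  moreover have "0 < a powr s" using \<open>0 < a\<close> by simp
  ultimately have Npos: "N > 0" by linarith
  then have n: "n > 0" by (simp add: n_def)
  have "N \<le> b powr s" unfolding N_def
    by (rule integral_le_const[OF int]) (use le in auto)
  then have "n \<le> (b powr s) powr (1 / s)"
    unfolding n_def using Npos s by (intro powr_mono2) auto
  then have nb: "n \<le> b" using b s by (simp add: powr_powr)
  have ns: "n powr s = N" using Npos s by (simp add: n_def powr_powr)
  have norm1: "(\<integral>x. (f x / n) powr s \<partial>M) = 1"
  proof -
    have "(\<integral>x. (f x / n) powr s \<partial>M) = (\<integral>x. f x powr s / n powr s \<partial>M)"
      by (intro Bochner_Integration.integral_cong refl powr_divide)
    also have "\<dots> = 1" using Npos by (simp add: ns N_def)
    finally show ?thesis .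
  qed
  obtain l where l: "l \<ge> 0" and
    D: "((\<lambda>t. Psi M (s + t) (\<lambda>x. f x / n + t / (s - 1))) has_real_derivative l) (at 0)"
    using Psi_deriv_along_flow_normalized[OF \<open>prob_space M\<close>, of "\<lambda>x. f x / n" "a / n" "b / n" s]
      norm1 \<open>0 < a\<close> n s range by (auto simp: divide_right_mono)
  have "((\<lambda>t. Psi M (s + t) (\<lambda>x. f x + t * (n / (s - 1)))) has_real_derivative n\<^sup>2 * l) (at 0)"
  proof (rule DERIV_cong_ev[THEN iffD2, OF refl _ refl DERIV_cmult[OF D]])
    have "\<forall>\<^sub>F t in nhds (0::real). t < 2 - s" "\<forall>\<^sub>F t in nhds (0::real). t > - s"
      "\<forall>\<^sub>F t in nhds (0::real). t > - (a / n * (s - 1))"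
      by (rule order_tendstoD[OF filterlim_ident]; use s \<open>0 < a\<close> n in simp)+
    then show "\<forall>\<^sub>F t in nhds 0. Psi M (s + t) (\<lambda>x. f x + t * (n / (s - 1)))
        = n\<^sup>2 * Psi M (s + t) (\<lambda>x. f x / n + t / (s - 1))"
    proof eventually_elim
      case (elim t)
      have "0 \<le> f x / n + t / (s - 1)" if "x \<in> space M" for x
      proof -
        have "- (a / n) \<le> t / (s - 1)" using elim(3) s by (simp add: pos_le_divide_eq)
        moreover have "a / n \<le> f x / n" using range[OF that] n by (simp add: divide_right_mono)
        ultimately show ?thesis by linarith
      qed
      then have "Psi M (s + t) (\<lambda>x. n * (f x / n + t / (s - 1)))
          = n\<^sup>2 * Psi M (s + t) (\<lambda>x. f x / n + t / (s - 1))"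
        by (intro Psi_scale) (use n elim in auto)
      then show ?case using n by (simp add: distrib_left mult.commute)
    qed
  qed
  then show ?thesis using n nb l by (intro exI[of _ n] exI[of _ "n\<^sup>2 * l"]) auto
qed

section \<open>Comparison of exponents up to a translation\<close>

lemma Psi_tendsto:
  assumes "prob_space M" and f [measurable]: "f \<in> borel_measurable M"
    and range: "\<And>x. x \<in> space M \<Longrightarrow> f x \<in> {0..b}"
    and S: "S \<longlonglongrightarrow> s" "\<And>n. 0 < S n" "\<And>n. S n < 2" and s: "0 < s" "s < 2"
    and C: "C \<longlonglongrightarrow> c" "\<And>n. 0 \<le> C n"
  shows "(\<lambda>n. Psi M (S n) (\<lambda>x. f x + C n)) \<longlonglongrightarrow> Psi M s (\<lambda>x. f x + c)"
proof -
  interpret prob_space M by fact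
  have "Bseq C" using C(1) convergentI convergent_imp_Bseq by blast
  then obtain K where K: "K > 0" "\<And>n. \<bar>C n\<bar> \<le> K" by (auto simp: Bseq_def)
  have bnd: "\<bar>(f x + C n) powr r\<bar> \<le> (1 + b + K)\<^sup>2" if "x \<in> space M" "0 < r" "r \<le> 2" for x n r
  proof -
    have "(f x + C n) powr r \<le> (1 + b + K) powr r"
      using range[OF that(1)] K(2)[of n] C(2)[of n] that by (intro powr_mono2) auto
    also have "\<dots> \<le> (1 + b + K) powr 2"
      using range[OF that(1)] K(1) that by (intro powr_mono) auto
    finally show ?thesis using range[OF that(1)] K(1) by simp
  qed
  have "(\<lambda>n. \<integral>x. (f x + C n)\<^sup>2 \<partial>M) \<longlonglongrightarrow> (\<integral>x. (f x + c)\<^sup>2 \<partial>M)"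
  proof (rule integral_dominated_convergence[where w = "\<lambda>_. (1 + b + K)\<^sup>2"])
    show "AE x in M. norm ((f x + C n)\<^sup>2) \<le> (1 + b + K)\<^sup>2" for n
    proof (rule AE_I2)
      fix x assume x: "x \<in> space M"
      show "norm ((f x + C n)\<^sup>2) \<le> (1 + b + K)\<^sup>2"
        using bnd[OF x, of 2 n] range[OF x] C(2)[of n] by simp
    qed
  qed (auto intro!: tendsto_intros C)
  moreover have "(\<lambda>n. \<integral>x. (f x + C n) powr S n \<partial>M) \<longlonglongrightarrow> (\<integral>x. (f x + c) powr s \<partial>M)"
  proof (rule integral_dominated_convergence[where w = "\<lambda>_. (1 + b + K)\<^sup>2"])
    show "AE x in M. norm ((f x + C n) powr S n) \<le> (1 + b + K)\<^sup>2" for n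
      using bnd S(2,3) by (intro AE_I2) (auto simp: less_imp_le)
    show "AE x in M. (\<lambda>n. (f x + C n) powr S n) \<longlonglongrightarrow> (f x + c) powr s"
      using range C(2) s by (intro AE_I2 tendsto_powr' tendsto_intros C S) auto
  qed auto
  ultimately show ?thesis
    unfolding Psi_def using s S(3)
    by (simp add: less_imp_neq)
       (intro tendsto_intros tendsto_powr' S;
        auto intro!: always_eventually Bochner_Integration.integral_nonneg)
qed

text \<open>
  A substitute for solving the differential equation \<open>c'(s) = \<parallel>f + c\<parallel>\<^sub>s / (s - 1)\<close> with \<open>c(q) = 0\<close>,
  along which \<open>\<Psi>\<^sub>s(f + c)\<close> increases. Since \<open>\<parallel>f + c\<parallel>\<^sub>s \<le> b + c\<close>, solutions stay below the solution
  \<open>b + c = b (s - 1) / (q - 1)\<close> of the linear equation \<open>c' = (b + c) / (s - 1)\<close>; below this curve the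
  pairs \<open>(s, c)\<close> with \<open>q \<le> s \<le> p\<close> and \<open>c \<ge> 0\<close> form a compact set \<open>K\<close>. The continuous
  function \<open>\<Psi>\<^sub>s(f + c) + \<epsilon> s\<close> attains its maximum over \<open>K\<close>. At a point with \<open>s < p\<close> the flow
  stays in \<open>K\<close> for a short time and increases this function strictly, so the maximum lies at
  \<open>s = p\<close>; comparing it with the value at \<open>(q, 0)\<close> gives the claim.
\<close>

lemma Psi_le_Psi_shift_bounded_below:
  assumes "prob_space M" and f [measurable]: "f \<in> borel_measurable M"
    and "0 < a" and range: "\<And>x. x \<in> space M \<Longrightarrow> f x \<in> {a..b}"
    and q: "1 < q" "q < p" and "p < 2" and "\<delta> > 0"
  shows "\<exists>c\<ge>0. Psi M q f \<le> Psi M p (\<lambda>x. f x + c) + \<delta>"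
proof -
  define \<epsilon> where "\<epsilon> = \<delta> / (p - q)"
  have "\<epsilon> > 0" and slope: "\<epsilon> * (p - q) = \<delta>" using q \<open>\<delta> > 0\<close> by (auto simp: \<epsilon>_def)
  interpret prob_space M by fact
  obtain x0 where "x0 \<in> space M" using not_empty by blast
  with range[of x0] \<open>0 < a\<close> have b: "b > 0" by auto
  define K where "K = ({q..p} \<times> {0..b * (p - 1) / (q - 1)})
      \<inter> {z. (q - 1) * (b + snd z) \<le> b * (fst z - 1)}"
  have K_iff: "(s, c) \<in> K \<longleftrightarrow> q \<le> s \<and> s \<le> p \<and> 0 \<le> c \<and> (q - 1) * (b + c) \<le> b * (s - 1)" for s c
  proof -
    have "c \<le> b * (p - 1) / (q - 1)" if "s \<le> p" "(q - 1) * (b + c) \<le> b * (s - 1)"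
    proof -
      have "(q - 1) * c \<le> (q - 1) * (b + c)" using q b by simp
      also have "\<dots> \<le> b * (p - 1)" using that b by (smt (verit) mult_left_mono)
      finally show ?thesis using q by (simp add: pos_le_divide_eq mult.commute)
    qed
    then show ?thesis unfolding K_def by auto
  qed
  have "compact K" unfolding K_def
    by (intro compact_Int_closed compact_Times compact_Icc closed_Collect_le continuous_intros)
  moreover have q0: "(q, 0) \<in> K" unfolding K_iff using q b by (simp add: mult.commute)
  moreover have "continuous_on K (\<lambda>z. Psi M (fst z) (\<lambda>x. f x + snd z) + \<epsilon> * fst z)"
    unfolding continuous_on_sequentially o_def
  proof safe
    fix s c X assume sc: "(s, c) \<in> K" and X: "\<forall>n. X n \<in> K" "X \<longlonglongrightarrow> (s, c)"
    have F: "(\<lambda>n. fst (X n)) \<longlonglongrightarrow> s" and S: "(\<lambda>n. snd (X n)) \<longlonglongrightarrow> c"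
      using tendsto_fst[OF X(2)] tendsto_snd[OF X(2)] by auto
    have XK: "q \<le> fst (X n) \<and> fst (X n) \<le> p \<and> 0 \<le> snd (X n)" for n
      using X(1) K_iff[of "fst (X n)" "snd (X n)"] by simp
    have "(\<lambda>n. Psi M (fst (X n)) (\<lambda>x. f x + snd (X n))) \<longlonglongrightarrow> Psi M s (\<lambda>x. f x + c)"
    proof (rule Psi_tendsto[OF \<open>prob_space M\<close> f _ F _ _ _ _ S])
      show "f x \<in> {0..b}" if "x \<in> space M" for x using range[OF that] \<open>0 < a\<close> by auto
      show "0 < fst (X n)" "fst (X n) < 2" "0 \<le> snd (X n)" for n
        using XK[of n] q \<open>p < 2\<close> by auto
      show "0 < s" "s < 2" using sc q \<open>p < 2\<close> by (auto simp: K_iff)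
    qed
    with F show "(\<lambda>n. Psi M (fst (X n)) (\<lambda>x. f x + snd (X n)) + \<epsilon> * fst (X n))
        \<longlonglongrightarrow> Psi M (fst (s, c)) (\<lambda>x. f x + snd (s, c)) + \<epsilon> * fst (s, c)"
      by (auto intro!: tendsto_intros)
  qed
  ultimately obtain z where "z \<in> K" and z: "\<forall>y\<in>K. Psi M (fst y) (\<lambda>x. f x + snd y) + \<epsilon> * fst y
      \<le> Psi M (fst z) (\<lambda>x. f x + snd z) + \<epsilon> * fst z"
    using continuous_attains_sup[of K "\<lambda>z. Psi M (fst z) (\<lambda>x. f x + snd z) + \<epsilon> * fst z"] by blast
  obtain s c where "z = (s, c)" by fastforce
  with \<open>z \<in> K\<close> z have sc: "(s, c) \<in> K" and
    max: "\<And>s' c'. (s', c') \<in> K \<Longrightarrow> Psi M s' (\<lambda>x. f x + c') + \<epsilon> * s' \<le> Psi M s (\<lambda>x. f x + c) + \<epsilon> * s"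
    by auto
  have "s = p"
  proof (rule ccontr)
    assume "s \<noteq> p"
    with sc q have s: "1 < s" "s < p" and c: "0 \<le> c" by (auto simp: K_iff)
    have "\<And>x. x \<in> space M \<Longrightarrow> f x + c \<in> {a..b + c}" using range c by fastforce
    then obtain n l where n: "0 < n" "n \<le> b + c" and l: "0 \<le> l" and
      D: "((\<lambda>t. Psi M (s + t) (\<lambda>x. (f x + c) + t * (n / (s - 1)))) has_real_derivative l) (at 0)"
      using Psi_deriv_along_flow[of M "\<lambda>x. f x + c" a "b + c" s] \<open>prob_space M\<close> \<open>0 < a\<close> s \<open>p < 2\<close>
      by (auto; blast)
    have "((\<lambda>t. Psi M (s + t) (\<lambda>x. (f x + c) + t * (n / (s - 1))) + \<epsilon> * (s + t))
        has_real_derivative l + \<epsilon> * (0 + 1)) (at 0)"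
      by (intro DERIV_add D DERIV_cmult DERIV_const DERIV_ident)
    from DERIV_pos_inc_right[OF this] l \<open>\<epsilon> > 0\<close> obtain d where "d > 0" and
      inc: "\<And>h. 0 < h \<Longrightarrow> h < d \<Longrightarrow> Psi M s (\<lambda>x. f x + c) + \<epsilon> * s
        < Psi M (s + h) (\<lambda>x. (f x + c) + h * (n / (s - 1))) + \<epsilon> * (s + h)"
      by auto
    define h where "h = min (d / 2) (p - s)"
    have h: "0 < h" "h < d" "h \<le> p - s" using \<open>d > 0\<close> s by (auto simp: h_def)
    (* The boundary curve of K has slope (b + c) / (s - 1), which is at least the speed of
       the flow. *)
    have "(s + h, c + h * (n / (s - 1))) \<in> K"
    proof -
      have "(q - 1) * (b + (c + h * (n / (s - 1)))) \<le> (q - 1) * ((b + c) + h * ((b + c) / (s - 1)))"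
        using n h s q by (intro mult_left_mono) (auto intro!: mult_left_mono divide_right_mono)
      also have "\<dots> = ((q - 1) * (b + c)) * (1 + h / (s - 1))"
        by (simp add: distrib_left distrib_right)
      also have "\<dots> \<le> (b * (s - 1)) * (1 + h / (s - 1))"
        using sc h s by (intro mult_right_mono) (auto simp: K_iff)
      also have "\<dots> = b * (s + h - 1)" using s by (simp add: field_simps)
      finally show ?thesis using sc h s n c by (auto simp: K_iff)
    qed
    from max[OF this] inc[OF h(1,2)] show False by (simp add: add.assoc)
  qed
  with max[OF q0] have "Psi M q f \<le> Psi M p (\<lambda>x. f x + c) + \<epsilon> * (p - q)"
    by (simp add: algebra_simps)
  with sc show ?thesis unfolding slope by (intro exI[of _ c]) (auto simp: K_iff)
qed

text \<open>
  This carries exponents \<open>s\<close> tending to \<open>2\<close> over to the entropy, with a factor \<open>s / 2\<close> that is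
  harmless in the limit. The reason is Jensen's inequality for the exponential and the measure
  \<open>f\<^sup>2 d\<mu>\<close>, applied to \<open>f powr s = f\<^sup>2 exp (-(2 - s) ln f)\<close>. It is used in the form of the tangent line
  of \<open>exp\<close> at \<open>y\<close>, the mean of the exponent with respect to that measure, normalised.
\<close>

lemma Psi_le_Psi_2:
  assumes "prob_space M" and f [measurable]: "f \<in> borel_measurable M"
    and "0 < a" and range: "\<And>x. x \<in> space M \<Longrightarrow> f x \<in> {a..b}"
    and s: "0 < s" "s < 2"
  shows "s / 2 * Psi M s f \<le> Psi M 2 f"
proof -
  interpret prob_space M by fact
  have fpos: "f x > 0" if "x \<in> space M" for x using range[OF that] \<open>0 < a\<close> by auto
  note int = integrable_continuous_compose[OF f _ range]
  define m where "m = (\<integral>x. (f x)\<^sup>2 \<partial>M)"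
  define L where "L = (\<integral>x. (f x)\<^sup>2 * ln ((f x)\<^sup>2) \<partial>M)"
  define N where "N = (\<integral>x. f x powr s \<partial>M)"
  have i2: "integrable M (\<lambda>x. (f x)\<^sup>2)" by (rule int) (auto intro!: continuous_intros)
  have il: "integrable M (\<lambda>x. (f x)\<^sup>2 * ln ((f x)\<^sup>2))"
    by (rule int) (use \<open>0 < a\<close> in \<open>auto intro!: continuous_intros\<close>)
  have ipow: "integrable M (\<lambda>x. f x powr s)"
    by (rule int) (use \<open>0 < a\<close> in \<open>auto intro!: continuous_intros\<close>)
  have "a\<^sup>2 \<le> m" unfolding m_def
    by (rule integral_ge_const[OF i2]) (use range \<open>0 < a\<close> in \<open>auto intro!: power_mono\<close>)
  moreover have "0 < a\<^sup>2" using \<open>0 < a\<close> by simp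
  ultimately have m: "m > 0" by linarith
  define y where "y = - (2 - s) * L / (2 * m)"
  have "m * exp y = exp y * (m * (1 - y) - (2 - s) / 2 * L)" using m by (simp add: y_def field_simps)
  also have "\<dots> = (\<integral>x. exp y * ((f x)\<^sup>2 * (1 - y) - (2 - s) / 2 * ((f x)\<^sup>2 * ln ((f x)\<^sup>2))) \<partial>M)"
    using i2 il by (simp add: m_def L_def)
  also have "\<dots> \<le> N" unfolding N_def
  proof (rule integral_mono_AE[OF _ ipow])
    show "AE x in M. exp y * ((f x)\<^sup>2 * (1 - y) - (2 - s) / 2 * ((f x)\<^sup>2 * ln ((f x)\<^sup>2))) \<le> f x powr s"
    proof (rule AE_I2)
      fix x assume "x \<in> space M"
      note p = fpos[OF this]
      have "exp y * ((f x)\<^sup>2 * (1 - y) - (2 - s) / 2 * ((f x)\<^sup>2 * ln ((f x)\<^sup>2)))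
          = (f x)\<^sup>2 * (exp y * (1 + (- (2 - s) * ln (f x) - y)))"
        using p by (simp add: ln_realpow field_simps)
      also have "\<dots> \<le> (f x)\<^sup>2 * (exp y * exp (- (2 - s) * ln (f x) - y))"
        by (intro mult_left_mono exp_ge_add_one_self) auto
      also have "\<dots> = f x powr s"
      proof -
        have "(f x)\<^sup>2 = f x powr 2" using p by simp
        also have "\<dots> = exp (2 * ln (f x))" using p by (simp add: powr_def)
        finally show ?thesis using p by (simp add: powr_def exp_add[symmetric] algebra_simps)
      qed
      finally show "exp y * ((f x)\<^sup>2 * (1 - y) - (2 - s) / 2 * ((f x)\<^sup>2 * ln ((f x)\<^sup>2))) \<le> f x powr s" .
    qed
  qed (use i2 il in auto)
  finally have N: "m * exp y \<le> N" .
  have "m - (2 - s) / s * (L - m * ln m) = m * (1 + ((2 / s - 1) * ln m + 2 * y / s))"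
    using s m by (simp add: y_def field_simps)
  also have "\<dots> \<le> m * exp ((2 / s - 1) * ln m + 2 * y / s)"
    using m by (intro mult_left_mono exp_ge_add_one_self) auto
  also have "\<dots> = exp (ln m) * exp ((2 / s - 1) * ln m + 2 * y / s)" using m by simp
  also have "\<dots> = exp (2 / s * (ln m + y))"
    unfolding exp_add[symmetric] by (simp add: algebra_simps add_divide_distrib)
  also have "\<dots> = (m * exp y) powr (2 / s)" using m by (simp add: powr_def ln_mult)
  also have "\<dots> \<le> N powr (2 / s)" using N m s by (intro powr_mono2) auto
  finally have "m - N powr (2 / s) \<le> (2 - s) / s * (L - m * ln m)" by linarith
  then have "(m - N powr (2 / s)) / (2 - s) \<le> (L - m * ln m) / s"
    using s by (simp add: field_simps)
  then have "s / 2 * ((m - N powr (2 / s)) / (2 - s)) \<le> s / 2 * ((L - m * ln m) / s)"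
    using s by (intro mult_left_mono) auto
  then show ?thesis
    using s by (simp add: Psi_def Ent_def m_def L_def N_def)
qed

text \<open>
  The remaining limit cases: a function that may vanish, the exponent \<open>q = 1\<close>, where the flow has
  infinite speed, and the exponent \<open>p = 2\<close>. The first two are removed together by moving to
  \<open>f + k\<close> with small \<open>k > 0\<close> and to an exponent \<open>t\<close> slightly above \<open>q\<close>, the third by
  stopping at an exponent \<open>s\<close> close to \<open>2\<close> and applying \<open>Psi_le_Psi_2\<close>.
\<close>

lemma Psi_le_Psi_shift_bounded:
  assumes "prob_space M" and f [measurable]: "f \<in> borel_measurable M"
    and range: "\<And>x. x \<in> space M \<Longrightarrow> f x \<in> {0..b}"
    and q: "1 \<le> q" "q < p" and "p \<le> 2" and "\<epsilon> > 0"
  shows "\<exists>c\<ge>0. Psi M q f \<le> Psi M p (\<lambda>x. f x + c) + \<epsilon>"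
proof -
  define C where "C n = 1 / (real n + 1)" for n :: nat
  define S where "S n = q + (p - q) / 2 * C n" for n :: nat
  have C0: "C \<longlonglongrightarrow> 0" unfolding C_def using lim_1_over_n[THEN LIMSEQ_Suc] by (simp add: add.commute)
  have "S \<longlonglongrightarrow> q + (p - q) / 2 * 0" unfolding S_def by (intro tendsto_intros C0)
  then have Sq: "S \<longlonglongrightarrow> q" by simp
  have Cpos: "C n > 0" for n by (simp add: C_def)
  have S1: "q < S n" "S n < p" for n
  proof -
    show "q < S n" using q Cpos by (simp add: S_def)
    have "(p - q) / 2 * C n \<le> (p - q) / 2 * 1"
      using q by (intro mult_left_mono) (auto simp: C_def)
    then show "S n < p" using q by (simp add: S_def field_simps)
  qed
  have "(\<lambda>n. Psi M (S n) (\<lambda>x. f x + C n)) \<longlonglongrightarrow> Psi M q (\<lambda>x. f x + 0)"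
    by (rule Psi_tendsto[OF \<open>prob_space M\<close> f range Sq _ _ _ _ C0])
       (use S1 q \<open>p \<le> 2\<close> Cpos in \<open>auto intro: less_imp_le less_trans less_le_trans order.strict_trans1[OF _ S1(1)]\<close>)
  then have "\<forall>\<^sub>F n in sequentially. Psi M q (\<lambda>x. f x + 0) - \<epsilon> / 2 < Psi M (S n) (\<lambda>x. f x + C n)"
    by (rule order_tendstoD) (use \<open>\<epsilon> > 0\<close> in auto)
  then obtain n where n: "Psi M q f - \<epsilon> / 2 < Psi M (S n) (\<lambda>x. f x + C n)"
    unfolding eventually_sequentially by auto
  define t where "t = S n"
  define k where "k = C n"
  have t: "1 < t" "t < p" and k: "k > 0" and n: "Psi M q f - \<epsilon> / 2 < Psi M t (\<lambda>x. f x + k)"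
    using S1[of n] q Cpos[of n] n by (auto simp: t_def k_def)
  have kr: "f x + k \<in> {k..b + k}" if "x \<in> space M" for x using range[OF that] by auto
  have fk: "(\<lambda>x. f x + k) \<in> borel_measurable M" by simp
  have "\<exists>c\<ge>0. Psi M t (\<lambda>x. f x + k) \<le> Psi M p (\<lambda>x. (f x + k) + c) + \<epsilon> / 2"
  proof (cases "p = 2")
    case False
    with \<open>p \<le> 2\<close> have "p < 2" by simp
    then show ?thesis
      using Psi_le_Psi_shift_bounded_below[OF \<open>prob_space M\<close> fk k kr t, of "\<epsilon> / 2"] \<open>\<epsilon> > 0\<close> by simp
  next
    case True
    define w where "w = Psi M t (\<lambda>x. f x + k)"
    have "((\<lambda>s. s / 2 * (w - \<epsilon> / 4)) \<longlongrightarrow> 2 / 2 * (w - \<epsilon> / 4)) (at_left 2)"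
      by (intro tendsto_intros) auto
    moreover have "w - \<epsilon> / 2 < 2 / 2 * (w - \<epsilon> / 4)" using \<open>\<epsilon> > 0\<close> by simp
    ultimately have "\<forall>\<^sub>F s in at_left 2. w - \<epsilon> / 2 < s / 2 * (w - \<epsilon> / 4)"
      by (rule order_tendstoD)
    moreover have "\<forall>\<^sub>F s in at_left 2. s \<in> {t<..<2}"
      by (rule eventually_at_leftI[of t]) (use t True in auto)
    ultimately have "\<forall>\<^sub>F s in at_left (2::real). w - \<epsilon> / 2 < s / 2 * (w - \<epsilon> / 4) \<and> s \<in> {t<..<2}"
      by (rule eventually_conj)
    then obtain s where s: "w - \<epsilon> / 2 < s / 2 * (w - \<epsilon> / 4)" "t < s" "s < 2"
      using eventually_happens[of _ "at_left (2::real)"] trivial_limit_at_left_real by fastforce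
    obtain c where c: "c \<ge> 0" "w \<le> Psi M s (\<lambda>x. (f x + k) + c) + \<epsilon> / 4"
      using Psi_le_Psi_shift_bounded_below[OF \<open>prob_space M\<close> fk k kr t(1) s(2,3), of "\<epsilon> / 4"] \<open>\<epsilon> > 0\<close>
      unfolding w_def by auto
    have "s / 2 * (w - \<epsilon> / 4) \<le> s / 2 * Psi M s (\<lambda>x. (f x + k) + c)"
      using c s t by (intro mult_left_mono) auto
    also have "\<dots> \<le> Psi M 2 (\<lambda>x. (f x + k) + c)"
      by (rule Psi_le_Psi_2[OF \<open>prob_space M\<close> _ k, of _ "b + k + c"])
         (use kr c s t in \<open>fastforce+\<close>)
    finally show ?thesis using s(1) c(1) True unfolding w_def by (intro exI[of _ c]) auto
  qed
  then obtain c where "c \<ge> 0" "Psi M t (\<lambda>x. f x + k) \<le> Psi M p (\<lambda>x. f x + (k + c)) + \<epsilon> / 2"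
    by (auto simp: add.assoc)
  with n k show ?thesis by (intro exI[of _ "k + c"]) auto
qed

lemma Psi_cong_AE:
  assumes [measurable]: "f \<in> borel_measurable M" "g \<in> borel_measurable M" and "AE x in M. f x = g x"
  shows "Psi M p f = Psi M p g"
proof -
  have "(\<integral>x. h (f x) \<partial>M) = (\<integral>x. h (g x) \<partial>M)"
    if [measurable]: "h \<in> borel_measurable borel" for h :: "real \<Rightarrow> real"
    by (rule integral_cong_AE) (use assms(3) in auto)
  from this[of "\<lambda>y. y\<^sup>2"] this[of "\<lambda>y. y powr p"] this[of "\<lambda>y. y\<^sup>2 * ln (y\<^sup>2)"]
  show ?thesis by (simp add: Psi_def Ent_def)
qed

lemma Psi_le_Psi_shift:
  assumes "prob_space M" and f [measurable]: "f \<in> borel_measurable M"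
    and nonneg: "AE x in M. 0 \<le> f x" and bdd: "AE x in M. \<bar>f x\<bar> \<le> b"
    and "1 \<le> q" "q < p" "p \<le> 2" "\<epsilon> > 0"
  shows "\<exists>c\<ge>0. Psi M q f \<le> Psi M p (\<lambda>x. f x + c) + \<epsilon>"
proof -
  define g where "g x = max 0 (min \<bar>b\<bar> (f x))" for x
  have [measurable]: "g \<in> borel_measurable M" unfolding g_def by measurable
  have ae: "AE x in M. f x = g x" using nonneg bdd by eventually_elim (auto simp: g_def)
  have "\<exists>c\<ge>0. Psi M q g \<le> Psi M p (\<lambda>x. g x + c) + \<epsilon>"
    by (rule Psi_le_Psi_shift_bounded[of M g "\<bar>b\<bar>"]) (use assms in \<open>auto simp: g_def\<close>)
  moreover have "Psi M q f = Psi M q g" by (rule Psi_cong_AE) (use ae in auto)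
  moreover have "Psi M p (\<lambda>x. f x + c) = Psi M p (\<lambda>x. g x + c)" for c
    by (rule Psi_cong_AE) (use ae in auto)
  ultimately show ?thesis by simp
qed

text \<open>
  Nonnegativity is needed to raise an inequality between values of \<open>\<Psi>\<close> to the power \<open>1 + \<theta>\<close>.
  It is the monotonicity of \<open>L\<^sup>q\<close> norms on a probability space, obtained by integrating Young's
  inequality between \<open>f\<^sup>2\<close> and the square of the \<open>L\<^sup>q\<close> norm \<open>n\<close>.
\<close>

lemma Psi_nonneg:
  assumes "prob_space M" and f [measurable]: "f \<in> borel_measurable M"
    and nonneg: "AE x in M. 0 \<le> f x" and bdd: "AE x in M. \<bar>f x\<bar> \<le> b"
    and q: "0 < q" "q < 2"
  shows "0 \<le> Psi M q f"
proof -
  interpret prob_space M by fact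
  define N where "N = (\<integral>x. f x powr q \<partial>M)"
  define n where "n = N powr (1 / q)"
  have N0: "N \<ge> 0" unfolding N_def by (rule Bochner_Integration.integral_nonneg) simp
  have n2: "n\<^sup>2 = N powr (2 / q)"
    unfolding n_def by (simp add: powr_powr flip: powr_numeral)
  have i2: "integrable M (\<lambda>x. (f x)\<^sup>2)"
  proof (rule integrable_const_bound[of _ "b\<^sup>2"])
    show "AE x in M. norm ((f x)\<^sup>2) \<le> b\<^sup>2" using bdd by eventually_elim (simp add: abs_le_square_iff[symmetric])
  qed auto
  have iq: "integrable M (\<lambda>x. f x powr q)"
  proof (rule integrable_const_bound[of _ "\<bar>b\<bar> powr q"])
    show "AE x in M. norm (f x powr q) \<le> \<bar>b\<bar> powr q" using bdd nonneg
      by eventually_elim (use q in \<open>auto intro!: powr_mono2\<close>)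
  qed auto
  have "n\<^sup>2 \<le> (\<integral>x. (f x)\<^sup>2 \<partial>M)"
  proof (cases "N = 0")
    case True
    then show ?thesis by (simp add: n_def)
  next
    case False
    with N0 have "n > 0" by (simp add: n_def)
    have "n\<^sup>2 = n powr 2" using \<open>n > 0\<close> by simp
    also have "\<dots> = n powr (2 - q) * n powr q" by (simp flip: powr_add)
    also have "n powr q = N" using q N0 False by (simp add: n_def powr_powr)
    also have "n powr (2 - q) * N = (\<integral>x. n powr (2 - q) * f x powr q \<partial>M)"
      by (simp add: N_def)
    also have "\<dots> \<le> (\<integral>x. q / 2 * (f x)\<^sup>2 + (1 - q / 2) * n\<^sup>2 \<partial>M)"
    proof (rule integral_mono_AE)
      show "AE x in M. n powr (2 - q) * f x powr q \<le> q / 2 * (f x)\<^sup>2 + (1 - q / 2) * n\<^sup>2"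
        using nonneg
      proof eventually_elim
        case (elim x)
        show ?case
        proof (cases "f x = 0")
          case False
          with elim have "f x > 0" by simp
          then have "((f x)\<^sup>2) powr (q / 2) * (n\<^sup>2) powr (1 - q / 2)
              \<le> q / 2 * (f x)\<^sup>2 + (1 - q / 2) * n\<^sup>2"
            using q \<open>n > 0\<close> by (intro Youngs_inequality_0) auto
          moreover have "((f x)\<^sup>2) powr (q / 2) = f x powr q" "(n\<^sup>2) powr (1 - q / 2) = n powr (2 - q)"
            using \<open>f x > 0\<close> \<open>n > 0\<close> by (simp_all add: powr_powr algebra_simps flip: powr_numeral)
          ultimately show ?thesis by (simp add: mult.commute)
        qed (use q in auto)
      qed
    qed (use i2 iq in auto)
    also have "\<dots> = q / 2 * (\<integral>x. (f x)\<^sup>2 \<partial>M) + (1 - q / 2) * n\<^sup>2"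
      using i2 by (simp add: prob_space)
    finally have "q / 2 * n\<^sup>2 \<le> q / 2 * (\<integral>x. (f x)\<^sup>2 \<partial>M)" by (simp add: algebra_simps)
    then show ?thesis using q by simp
  qed
  then show ?thesis unfolding Psi_def n2 N_def using q by simp
qed

section \<open>Translation invariance of the energy and the oscillation\<close>

lemma (in conservative_symmetric_dirichlet_form) const_dom: "(\<lambda>x. c) \<in> D"
  using dom_scale[OF one_dom, of c] by simp

text \<open>
  Since \<open>\<E>(1,1) = 0\<close>, the energy of \<open>f + t\<close> is affine in \<open>t\<close>. It is nonnegative for every \<open>t\<close>,
  so its slope \<open>2 \<E>(f,1)\<close> has to be \<open>0\<close>.
\<close>

lemma (in conservative_symmetric_dirichlet_form) form_shift:
  assumes f: "f \<in> D"
  shows "E (\<lambda>x. f x + c) (\<lambda>x. f x + c) = E f f"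
proof -
  have expand: "E (\<lambda>x. f x + t) (\<lambda>x. f x + t) = E f f + 2 * t * E f (\<lambda>x. 1)" for t
  proof -
    have t: "(\<lambda>x. f x + t) \<in> D" and k: "(\<lambda>x. t) \<in> D" using f const_dom dom_add by auto
    have s: "E (\<lambda>x. t) h = t * E (\<lambda>x. 1) h" if "h \<in> D" for h
      using form_scale[OF one_dom that, of t] by simp
    have "E (\<lambda>x. f x + t) (\<lambda>x. f x + t) = E (\<lambda>x. f x + t) f + E (\<lambda>x. f x + t) (\<lambda>x. t)"
      using form_add[OF f k t] form_sym[OF f t] form_sym[OF k t] by simp
    also have "\<dots> = E f f + E (\<lambda>x. t) f + (E f (\<lambda>x. t) + E (\<lambda>x. t) (\<lambda>x. t))"
      using form_add[OF f k f] form_add[OF f k k] by simp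
    also have "E f (\<lambda>x. t) = E (\<lambda>x. t) f" by (rule form_sym[OF f k])
    also have "E (\<lambda>x. t) f = t * E f (\<lambda>x. 1)"
      unfolding s[OF f] form_sym[OF one_dom f] ..
    also have "E (\<lambda>x. t) (\<lambda>x. t) = 0"
      unfolding s[OF k] form_sym[OF one_dom k] s[OF one_dom] one_form by simp
    finally have "E (\<lambda>x. f x + t) (\<lambda>x. f x + t)
        = E f f + t * E f (\<lambda>x. 1) + (t * E f (\<lambda>x. 1) + 0)" .
    then show ?thesis by simp
  qed
  have "E f (\<lambda>x. 1) = 0"
  proof (rule ccontr)
    assume ne: "E f (\<lambda>x. 1) \<noteq> 0"
    (* For this t the affine function of t takes the value -1. *)
    define t where "t = - (E f f + 1) / (2 * E f (\<lambda>x. 1))"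
    have "0 \<le> E (\<lambda>x. f x + t) (\<lambda>x. f x + t)"
      using form_nonneg dom_add[OF f const_dom] by blast
    also have "\<dots> = -1" unfolding expand using ne by (simp add: t_def field_simps)
    finally show False by simp
  qed
  then show ?thesis using expand by simp
qed

lemma esssup_shift:
  fixes g :: "'a \<Rightarrow> ereal"
  assumes [measurable]: "g \<in> borel_measurable M"
  shows "esssup M (\<lambda>x. g x + ereal c) = esssup M g + ereal c"
proof (rule antisym)
  have le: "esssup M (\<lambda>x. h x + ereal k) \<le> esssup M h + ereal k"
    if [measurable]: "h \<in> borel_measurable M" for h :: "'a \<Rightarrow> ereal" and k
  proof (rule esssup_I)
    show "AE x in M. h x + ereal k \<le> esssup M h + ereal k"
      using esssup_AE[of h M] by eventually_elim (rule add_right_mono)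
  qed auto
  show "esssup M (\<lambda>x. g x + ereal c) \<le> esssup M g + ereal c" by (rule le) simp
  have "(\<lambda>x. g x + ereal c + ereal (- c)) = g"
  proof
    fix x show "g x + ereal c + ereal (- c) = g x" by (cases "g x") auto
  qed
  then have "esssup M g \<le> esssup M (\<lambda>x. g x + ereal c) + ereal (- c)"
    using le[of "\<lambda>x. g x + ereal c" "- c"] by simp
  then show "esssup M g + ereal c \<le> esssup M (\<lambda>x. g x + ereal c)"
    by (cases "esssup M g"; cases "esssup M (\<lambda>x. g x + ereal c)") auto
qed

lemma Osc_shift:
  assumes [measurable]: "f \<in> borel_measurable M"
  shows "Osc M (\<lambda>x. f x + c) = Osc M f"
proof -
  have 1: "esssup M (\<lambda>x. ereal (f x + c)) = esssup M (\<lambda>x. ereal (f x)) + ereal c"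
    using esssup_shift[of "\<lambda>x. ereal (f x)" M c] by simp
  have 2: "esssup M (\<lambda>x. - ereal (f x + c)) = esssup M (\<lambda>x. - ereal (f x)) + ereal (- c)"
    using esssup_shift[of "\<lambda>x. - ereal (f x)" M "- c"] by simp
  show ?thesis
    unfolding Osc_def essinf_def 1 2
    by (cases "esssup M (\<lambda>x. ereal (f x))"; cases "esssup M (\<lambda>x. - ereal (f x))") auto
qed

section \<open>Transfer of the functional inequalities\<close>

context conservative_symmetric_dirichlet_form
begin

lemma shift_bounded_nonneg:
  assumes f: "f \<in> bounded_nonneg M D" and "c \<ge> 0"
  shows "(\<lambda>x. f x + c) \<in> bounded_nonneg M D"
proof -
  from f obtain k where D: "f \<in> D" and nn: "AE x in M. 0 \<le> f x" and k: "AE x in M. \<bar>f x\<bar> \<le> k"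
    by (auto simp: bounded_nonneg_def)
  have "AE x in M. \<bar>f x + c\<bar> \<le> k + c" using k by eventually_elim (use \<open>c \<ge> 0\<close> in auto)
  moreover have "AE x in M. 0 \<le> f x + c" using nn by eventually_elim (use \<open>c \<ge> 0\<close> in auto)
  ultimately show ?thesis
    unfolding bounded_nonneg_def using dom_add[OF D const_dom] by blast
qed

lemma bounded_nonneg_measurable: "f \<in> bounded_nonneg M D \<Longrightarrow> f \<in> borel_measurable M"
  using dom_L2 unfolding bounded_nonneg_def L2_def by blast

text \<open>
  All that is used about the translation from here on: it replaces \<open>f\<close> by an admissible \<open>g\<close> with
  the same right-hand side in both functional inequalities, and with at least the same left-hand
  side up to \<open>\<epsilon>\<close> after passing from \<open>q\<close> to \<open>p\<close>.
\<close>

lemma shift_dominates: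
  assumes "prob_space M" and f: "f \<in> bounded_nonneg M D"
    and "1 \<le> q" "q < p" "p \<le> 2" "\<epsilon> > 0"
  obtains g where "g \<in> bounded_nonneg M D" "Psi M q f \<le> Psi M p g + \<epsilon>"
    "E g g = E f f" "Osc M g = Osc M f"
proof -
  have m: "f \<in> borel_measurable M" using f by (rule bounded_nonneg_measurable)
  from f obtain k where D: "f \<in> D" and nn: "AE x in M. 0 \<le> f x" and k: "AE x in M. \<bar>f x\<bar> \<le> k"
    by (auto simp: bounded_nonneg_def)
  from Psi_le_Psi_shift[OF assms(1) m nn k assms(3-6)] obtain c
    where c: "c \<ge> 0" "Psi M q f \<le> Psi M p (\<lambda>x. f x + c) + \<epsilon>" by blast
  show thesis
    by (rule that[OF shift_bounded_nonneg[OF f c(1)] c(2) form_shift[OF D] Osc_shift[OF m]])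
qed

lemma weak_ineq_antimono:
  assumes "prob_space M" "1 \<le> q" "q \<le> p" "p \<le> 2" and w: "weak_ineq M D E p \<theta> A"
  shows "weak_ineq M D E q \<theta> A"
proof (cases "q = p")
  case False
  with assms have "q < p" by simp
  show ?thesis unfolding weak_ineq_def
  proof (intro ballI allI impI, rule field_le_epsilon)
    fix f and r \<epsilon> :: real assume f: "f \<in> bounded_nonneg M D" and "r > 0" "\<epsilon> > 0"
    obtain g where g: "g \<in> bounded_nonneg M D" "Psi M q f \<le> Psi M p g + \<epsilon>"
      "E g g = E f f" "Osc M g = Osc M f"
      using shift_dominates[OF \<open>prob_space M\<close> f \<open>1 \<le> q\<close> \<open>q < p\<close> \<open>p \<le> 2\<close> \<open>\<epsilon> > 0\<close>] .
    have "Psi M p g \<le> A * r powr - \<theta> * E g g + r * (Osc M g)\<^sup>2"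
      using w g(1) \<open>r > 0\<close> unfolding weak_ineq_def by blast
    with g(2) show "Psi M q f \<le> A * r powr - \<theta> * E f f + r * (Osc M f)\<^sup>2 + \<epsilon>"
      unfolding g(3,4) by linarith
  qed
qed (use w in simp)

lemma nash_ineq_antimono:
  assumes "prob_space M" "1 \<le> q" "q \<le> p" "p \<le> 2" and "\<theta> > 0"
    and w: "nash_ineq M D E p \<theta> C" and "C \<ge> 0"
  shows "nash_ineq M D E q \<theta> C"
proof (cases "q = p")
  case False
  with assms have "q < p" by simp
  show ?thesis unfolding nash_ineq_def
  proof
    fix f assume f: "f \<in> bounded_nonneg M D"
    then obtain k where D: "f \<in> D" and nn: "AE x in M. 0 \<le> f x" and k: "AE x in M. \<bar>f x\<bar> \<le> k"
      by (auto simp: bounded_nonneg_def)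
    define R where "R = C * E f f * Osc M f powr (2 * \<theta>)"
    have "R \<ge> 0" unfolding R_def using \<open>C \<ge> 0\<close> form_nonneg[OF D] by simp
    (* Taking the root first keeps the error \<epsilon> additive. *)
    have le: "Psi M q f \<le> R powr (1 / (1 + \<theta>))"
    proof (rule field_le_epsilon)
      fix \<epsilon> :: real assume "\<epsilon> > 0"
      obtain g where g: "g \<in> bounded_nonneg M D" "Psi M q f \<le> Psi M p g + \<epsilon>"
        "E g g = E f f" "Osc M g = Osc M f"
        using shift_dominates[OF \<open>prob_space M\<close> f \<open>1 \<le> q\<close> \<open>q < p\<close> \<open>p \<le> 2\<close> \<open>\<epsilon> > 0\<close>] .
      have "Psi M p g \<le> R powr (1 / (1 + \<theta>))"
      proof (cases "Psi M p g > 0")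
        case True
        have "Psi M p g powr (1 + \<theta>) \<le> R"
          using w g(1) unfolding nash_ineq_def R_def g(3,4)[symmetric] by blast
        then have "(Psi M p g powr (1 + \<theta>)) powr (1 / (1 + \<theta>)) \<le> R powr (1 / (1 + \<theta>))"
          using \<open>\<theta> > 0\<close> by (intro powr_mono2) auto
        then show ?thesis using True \<open>\<theta> > 0\<close> by (simp add: powr_powr)
      next
        case False
        then show ?thesis by (meson not_less order_trans powr_ge_zero)
      qed
      with g(2) show "Psi M q f \<le> R powr (1 / (1 + \<theta>)) + \<epsilon>" by simp
    qed
    have "0 \<le> Psi M q f"
      by (rule Psi_nonneg[OF \<open>prob_space M\<close> bounded_nonneg_measurable[OF f] nn k])
         (use assms \<open>q < p\<close> in auto)
    then have "Psi M q f powr (1 + \<theta>) \<le> (R powr (1 / (1 + \<theta>))) powr (1 + \<theta>)"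
      using le \<open>\<theta> > 0\<close> by (intro powr_mono2) auto
    also have "\<dots> = R" using \<open>R \<ge> 0\<close> \<open>\<theta> > 0\<close> by (simp add: powr_powr)
    finally show "Psi M q f powr (1 + \<theta>) \<le> C * E f f * Osc M f powr (2 * \<theta>)"
      unfolding R_def .
  qed
qed (use w in simp)

end

theorem corollary5p3:
  fixes M :: "'a measure"
    and D :: "('a \<Rightarrow> real) set"
    and E :: "('a \<Rightarrow> real) \<Rightarrow> ('a \<Rightarrow> real) \<Rightarrow> real"
    and \<theta> :: real
  assumes "prob_space M"
    and "conservative_symmetric_dirichlet_form M D E"
    and "\<theta> > 0"
  shows "(\<forall>p\<in>{1..2}. \<forall>A\<ge>0. weak_ineq M D E p \<theta> A \<longrightarrow> (\<forall>q\<in>{1..p}. weak_ineq M D E q \<theta> A))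
    \<and> (\<forall>p q. 1 \<le> q \<and> q \<le> p \<and> p \<le> 2 \<longrightarrow>
          A_opt M D E q \<theta> \<le> A_opt M D E p \<theta> \<and> C_opt M D E q \<theta> \<le> C_opt M D E p \<theta>)
    \<and> mono_on {1..2} (\<lambda>p. A_opt M D E p \<theta>)
    \<and> mono_on {1..2} (\<lambda>p. C_opt M D E p \<theta>)"
proof -
  interpret conservative_symmetric_dirichlet_form M D E by fact
  have A: "A_opt M D E q \<theta> \<le> A_opt M D E p \<theta>" if "1 \<le> q" "q \<le> p" "p \<le> 2" for p q
    unfolding A_opt_def
    by (intro Inf_superset_mono) (use weak_ineq_antimono[OF assms(1) that] in auto)
  have C: "C_opt M D E q \<theta> \<le> C_opt M D E p \<theta>" if "1 \<le> q" "q \<le> p" "p \<le> 2" for p q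
    unfolding C_opt_def
    by (intro Inf_superset_mono) (use nash_ineq_antimono[OF assms(1) that assms(3)] in auto)
  show ?thesis
  proof (intro conjI ballI allI impI mono_onI)
    show "weak_ineq M D E q \<theta> a" if "p \<in> {1..2}" "weak_ineq M D E p \<theta> a" "q \<in> {1..p}" for p q a
      by (rule weak_ineq_antimono[OF assms(1) _ _ _ that(2)]) (use that in auto)
    show "A_opt M D E q \<theta> \<le> A_opt M D E p \<theta>" "C_opt M D E q \<theta> \<le> C_opt M D E p \<theta>"
      if "1 \<le> q \<and> q \<le> p \<and> p \<le> 2" for p q
      using A C that by blast+
    show "A_opt M D E q \<theta> \<le> A_opt M D E p \<theta>" "C_opt M D E q \<theta> \<le> C_opt M D E p \<theta>"
      if "q \<in> {1..2}" "p \<in> {1..2}" "q \<le> p" for p q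
      using A[of q p] C[of q p] that by simp_all
  qed
qed

end
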